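(* Let $a<b$ be real numbers and $\alpha\in(0,1)$. Let $L:[a,b]\times\mathbb{R}^2\to\mathbb{R}$ be such that $L(\underline{x},\underline{u},v)$ is convex in $[a,b]\times\mathbb{R}^2$ (convexity in the third variable only, as defined in the context). Let $[a,b]\times\mathbb{R}\subseteq D\subseteq\mathbb{R}^2$, let $\Phi:D\to\mathbb{R}$ be an exact field for $L$ covering $[a,b]\times\mathbb{R}$, and let $y_0:[a,b]\to\mathbb{R}$ be an admissible function which is a solution of the fractional equation $${}_aD_x^{\alpha}y(x)=\Phi\bigl(x,{}_aI_x^{1-\alpha}y(x)\bigr),\qquad x\in[a,b].$$ Then $y_0$ is a minimizer of $$\mathcal{J}(y)=\int_a^b L\bigl(x,{}_aI_x^{1-\alpha}y(x),{}_aD_x^{\alpha}y(x)\bigr)\,dx$$ among the admissible functions $y:[a,b]\to\mathbb{R}$ satisfying the constraints $${}_aI_a^{1-\alpha}y(a)={}_aI_a^{1-\alpha}y_0(a),\qquad {}_aI_b^{1-\alpha}y(b)={}_aI_b^{1-\alpha}y_0(b),$$ i.e. $\mathcal{J}(y_0)\le\mathcal{J}(y)$ for every such $y$.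
   Context: Fractional operators. For $\gamma\in(0,1)$ and $f$ defined on $[a,b]$: the left Riemann-Liouville fractional integral is ${}_aI_x^{\gamma}f(x)=\frac{1}{\Gamma(\gamma)}\int_a^x (x-t)^{\gamma-1}f(t)\,dt$, and the left Riemann-Liouville fractional derivative is ${}_aD_x^{\gamma}f(x)=\frac{d}{dx}\,{}_aI_x^{1-\gamma}f(x)$. The symbols ${}_aI_a^{1-\alpha}y(a)$ and ${}_aI_b^{1-\alpha}y(b)$ denote the values of the function $x\mapsto{}_aI_x^{1-\alpha}y(x)$ at $x=a$ and $x=b$. $\partial_k$ denotes the partial derivative with respect to the $k$-th argument. Admissible functions are functions $y:[a,b]\to\mathbb{R}$ such that ${}_aI_x^{1-\alpha}y(x)$ and ${}_aD_x^{\alpha}y(x)$ exist on the closed interval $[a,b]$ (and for which $\mathcal{J}(y)$ is defined). Convexity: $L(\underline{x},\underline{u},v)$ is convex in $S\subseteq\mathbb{R}^3$ if $\partial_3L$ exists and is continuous and $$L(x,u,v+v_1)-L(x,u,v)\ge\partial_3L(x,u,v)\,v_1$$ for all $(x,u,v),(x,u,v+v_1)\in S$ (the underlined variables are held fixed). Exact field: a $C^1$ function $\Phi:D\to\mathbb{R}$ is an exact field for $L$ if there exists a function $S\in C^1(D,\mathbb{R})$ such that $$\partial_1S(x,y)=L(x,y,\Phi(x,y))-\partial_3L(x,y,\Phi(x,y))\,\Phi(x,y),\qquad \partial_2S(x,y)=\partial_3L(x,y,\Phi(x,y));$$ here, covering $[a,b]\times\mathbb{R}$ means that these identities hold for all $(x,y)\in[a,b]\times\mathbb{R}$.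 *)

theory Defs
  imports "HOL-Analysis.Analysis"
begin

text \<open>
  A function on \<open>[a,b]\<close> is represented by a total function whose values outside \<open>[a,b]\<close> are
  irrelevant. Integrals are Lebesgue integrals.
\<close>

definition rl_integrand :: "real \<Rightarrow> (real \<Rightarrow> real) \<Rightarrow> real \<Rightarrow> real \<Rightarrow> real" where
  "rl_integrand \<gamma> f x t = (x - t) powr (\<gamma> - 1) * f t"

definition rl_integral :: "real \<Rightarrow> real \<Rightarrow> (real \<Rightarrow> real) \<Rightarrow> real \<Rightarrow> real" where
  "rl_integral a \<gamma> f x = 1 / Gamma \<gamma> * (LINT t:{a..x}|lebesgue. rl_integrand \<gamma> f x t)"

text \<open>
  The right end point \<open>b\<close> of the domain of \<open>f\<close> is a parameter because the derivative at \<open>a\<close> and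
  at \<open>b\<close> is the one-sided one.
\<close>

definition rl_derivative :: "real \<Rightarrow> real \<Rightarrow> real \<Rightarrow> (real \<Rightarrow> real) \<Rightarrow> real \<Rightarrow> real" where
  "rl_derivative a b \<gamma> f x =
     vector_derivative (rl_integral a (1 - \<gamma>) f) (at x within {a..b})"

definition rl_integral_exists :: "real \<Rightarrow> real \<Rightarrow> real \<Rightarrow> (real \<Rightarrow> real) \<Rightarrow> bool" where
  "rl_integral_exists a b \<gamma> f \<longleftrightarrow>
     (\<forall>x\<in>{a..b}. set_integrable lebesgue {a..x} (rl_integrand \<gamma> f x))"

definition rl_derivative_exists :: "real \<Rightarrow> real \<Rightarrow> real \<Rightarrow> (real \<Rightarrow> real) \<Rightarrow> bool" where
  "rl_derivative_exists a b \<gamma> f \<longleftrightarrow>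
     (\<forall>x\<in>{a..b}. rl_integral a (1 - \<gamma>) f differentiable (at x within {a..b}))"

definition lagrangian_along ::
    "(real \<Rightarrow> real \<Rightarrow> real \<Rightarrow> real) \<Rightarrow> real \<Rightarrow> real \<Rightarrow> real \<Rightarrow> (real \<Rightarrow> real) \<Rightarrow> real \<Rightarrow> real" where
  "lagrangian_along L a b \<alpha> y x =
     L x (rl_integral a (1 - \<alpha>) y x) (rl_derivative a b \<alpha> y x)"

definition frac_functional ::
    "(real \<Rightarrow> real \<Rightarrow> real \<Rightarrow> real) \<Rightarrow> real \<Rightarrow> real \<Rightarrow> real \<Rightarrow> (real \<Rightarrow> real) \<Rightarrow> real" where
  "frac_functional L a b \<alpha> y = (LINT x:{a..b}|lebesgue. lagrangian_along L a b \<alpha> y x)"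

definition admissible ::
    "(real \<Rightarrow> real \<Rightarrow> real \<Rightarrow> real) \<Rightarrow> real \<Rightarrow> real \<Rightarrow> real \<Rightarrow> (real \<Rightarrow> real) \<Rightarrow> bool" where
  "admissible L a b \<alpha> y \<longleftrightarrow>
     rl_integral_exists a b (1 - \<alpha>) y \<and>
     rl_derivative_exists a b \<alpha> y \<and>
     set_integrable lebesgue {a..b} (lagrangian_along L a b \<alpha> y)"

definition partial3 :: "(real \<Rightarrow> real \<Rightarrow> real \<Rightarrow> real) \<Rightarrow> real \<Rightarrow> real \<Rightarrow> real \<Rightarrow> real" where
  "partial3 L x u v = deriv (\<lambda>w. L x u w) v"

definition convex_in_third ::
    "(real \<Rightarrow> real \<Rightarrow> real \<Rightarrow> real) \<Rightarrow> (real \<times> real \<times> real) set \<Rightarrow> bool" where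
  "convex_in_third L S \<longleftrightarrow>
     (\<forall>(x, u, v)\<in>S. (\<lambda>w. L x u w) differentiable (at v)) \<and>
     continuous_on S (\<lambda>(x, u, v). partial3 L x u v) \<and>
     (\<forall>x u v v1. (x, u, v) \<in> S \<longrightarrow> (x, u, v + v1) \<in> S \<longrightarrow>
        L x u (v + v1) - L x u v \<ge> partial3 L x u v * v1)"

text \<open>
  The domain \<open>D\<close> need not be open, so derivatives are taken within \<open>D\<close>; for open \<open>D\<close> this is
  the usual notion of a \<open>C\<^sup>1\<close> function.
\<close>

definition C1_on ::
    "('a::real_normed_vector \<Rightarrow> 'b::real_normed_vector) \<Rightarrow> 'a set \<Rightarrow> bool" where
  "C1_on f D \<longleftrightarrow>
     (\<exists>f' :: 'a \<Rightarrow> 'a \<Rightarrow>\<^sub>L 'b.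
        (\<forall>p\<in>D. (f has_derivative blinfun_apply (f' p)) (at p within D)) \<and>
        continuous_on D f')"

text \<open>
  The partial derivatives of \<open>S\<close> are derivatives along the horizontal and vertical sections
  of \<open>D\<close>. They are unique on \<open>[a,b] \<times> \<real>\<close> if \<open>a < b\<close> and \<open>[a,b] \<times> \<real> \<subseteq> D\<close>.
\<close>

definition exact_field_covering ::
    "real \<Rightarrow> real \<Rightarrow> (real \<times> real) set \<Rightarrow> (real \<Rightarrow> real \<Rightarrow> real \<Rightarrow> real) \<Rightarrow>
     (real \<times> real \<Rightarrow> real) \<Rightarrow> bool" where
  "exact_field_covering a b D L \<Phi> \<longleftrightarrow>
     C1_on \<Phi> D \<and>
     (\<exists>S :: real \<times> real \<Rightarrow> real. C1_on S D \<and>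
        (\<forall>(x, y)\<in>{a..b} \<times> UNIV.
           ((\<lambda>t. S (t, y)) has_real_derivative
              L x y (\<Phi> (x, y)) - partial3 L x y (\<Phi> (x, y)) * \<Phi> (x, y))
             (at x within {t. (t, y) \<in> D}) \<and>
           ((\<lambda>w. S (x, w)) has_real_derivative partial3 L x y (\<Phi> (x, y)))
             (at y within {w. (x, w) \<in> D})))"

end

theory Submission
  imports Defs
begin

text \<open>
  Write \<open>u x\<close> for the fractional integral of \<open>y\<close> of order \<open>1 - \<alpha>\<close>. The fractional derivative
  of \<open>y\<close> is the ordinary derivative \<open>u'\<close>, so the functional is
  \<open>\<integral> L(x, u, u')\<close> and Hilbert's invariant integral applies to it. If \<open>S\<close> is the potential of
  the exact field \<open>\<Phi>\<close>, the chain rule gives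

  \<open>d/dx S(x, u x) = L(x, u, \<Phi>(x, u)) + \<partial>\<^sub>3L(x, u, \<Phi>(x, u)) (u' - \<Phi>(x, u))\<close>.

  Convexity of \<open>L\<close> in its third argument bounds the right-hand side by \<open>L(x, u, u')\<close>, with
  equality when \<open>u' = \<Phi>(x, u)\<close>. Hence \<open>S(b, u b) - S(a, u a)\<close> is at most the functional at every
  admissible \<open>y\<close> (\<open>increment_le_frac_functional\<close>) and equal to it at a solution of the field
  equation (\<open>increment_eq_frac_functional\<close>). The increment depends only on the boundary values of
  \<open>u\<close>, which the constraints prescribe, so the two facts together give minimality.

  The derivative of \<open>x \<mapsto> S(x, u x)\<close> exists everywhere but may be discontinuous. It is therefore
  integrated in the sense of Henstock and Kurzweil, where every derivative is integrable with
  integral the increment; on the Lebesgue integrable Lagrangian the two integrals agree.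
\<close>

text \<open>
  Partial derivatives are given along the sections of \<open>D\<close>, whose shape outside the strip is
  arbitrary. The total derivative and the section derivatives are compared on the part of each
  section inside the strip, an interval of positive length, where derivatives are unique.
\<close>

lemma chain_rule_graph_strip:
  fixes S :: "real \<times> real \<Rightarrow> real"
  assumes "a < b" and x: "x \<in> {a..b}" and sub: "{a..b} \<times> UNIV \<subseteq> D"
    and C1: "C1_on S D"
    and p1: "((\<lambda>t. S (t, u x)) has_real_derivative p) (at x within {t. (t, u x) \<in> D})"
    and p2: "((\<lambda>w. S (x, w)) has_real_derivative q) (at (u x) within {w. (x, w) \<in> D})"
    and u: "(u has_real_derivative v) (at x within {a..b})"
  shows "((\<lambda>t. S (t, u t)) has_real_derivative p + q * v) (at x within {a..b})"
proof -
  have "(x, u x) \<in> D"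
    using x sub by blast
  then obtain S' where S': "(S has_derivative S') (at (x, u x) within D)"
    using C1 unfolding C1_on_def by blast
  then interpret S': bounded_linear S'
    by (rule has_derivative_bounded_linear)
  have scale: "S' (h * c, h * d) = S' (c, d) * h" for c d h
    using S'.scaleR[of h "(c, d)"] by simp
  \<comment> \<open>Used for the horizontal section, the vertical section and the graph of \<open>u\<close>: the first two
    identify \<open>S'\<close> with \<open>p\<close> and \<open>q\<close>, the third gives the claim.\<close>
  have curve: "((\<lambda>t. S (f t)) has_real_derivative S' (c, d)) (at z within T)"
    if f: "(f has_derivative (\<lambda>h. (h * c, h * d))) (at z within T)"
      and "f z = (x, u x)" "f ` T \<subseteq> D" for f :: "real \<Rightarrow> real \<times> real" and c d z T
  proof -
    have "(S has_derivative S') (at (f z) within f ` T)"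
      using has_derivative_subset[OF S'] that by simp
    from has_derivative_in_compose[OF f this] show ?thesis
      by (simp add: has_field_derivative_def scale)
  qed
  have "((\<lambda>t. S (t, u x)) has_real_derivative S' (1, 0)) (at x within {a..b})"
    by (rule curve) (use sub in \<open>auto intro!: derivative_eq_intros\<close>)
  moreover have "((\<lambda>t. S (t, u x)) has_real_derivative p) (at x within {a..b})"
    using p1 by (rule DERIV_subset) (use sub in auto)
  ultimately have 1: "S' (1, 0) = p"
    using vector_derivative_unique_within_closed_interval[of a b x] \<open>a < b\<close> x
    by (simp add: has_real_derivative_iff_has_vector_derivative)
  have "((\<lambda>w. S (x, w)) has_real_derivative S' (0, 1)) (at (u x))"
    by (rule curve) (use sub x in \<open>auto intro!: derivative_eq_intros\<close>)
  moreover have "((\<lambda>w. S (x, w)) has_real_derivative q) (at (u x))"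
    using p2 by (rule DERIV_subset) (use sub x in auto)
  ultimately have 2: "S' (0, 1) = q"
    by (rule DERIV_unique)
  have "((\<lambda>t. (t, u t)) has_derivative (\<lambda>h. (h * 1, h * v))) (at x within {a..b})"
    using u by (auto simp: has_field_derivative_def mult.commute intro!: derivative_eq_intros)
  then have "((\<lambda>t. S (t, u t)) has_real_derivative S' (1, v)) (at x within {a..b})"
    by (rule curve) (use sub in auto)
  moreover have "S' (1, v) = p + q * v"
    using S'.add[of "(1, 0)" "(0, v)"] scale[of v 0 1] 1 2 by simp
  ultimately show ?thesis
    by simp
qed

text \<open>
  The data of an exact field packaged for one potential \<open>S\<close>, so that the same \<open>S\<close> can be
  used for \<open>y0\<close> and for its competitors.
\<close>

definition field_potential ::
    "real \<Rightarrow> real \<Rightarrow> (real \<times> real) set \<Rightarrow> (real \<Rightarrow> real \<Rightarrow> real \<Rightarrow> real) \<Rightarrow>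
     (real \<times> real \<Rightarrow> real) \<Rightarrow> (real \<times> real \<Rightarrow> real) \<Rightarrow> bool" where
  "field_potential a b D L \<Phi> S \<longleftrightarrow> C1_on S D \<and>
     (\<forall>(x, y)\<in>{a..b} \<times> UNIV.
        ((\<lambda>t. S (t, y)) has_real_derivative
           L x y (\<Phi> (x, y)) - partial3 L x y (\<Phi> (x, y)) * \<Phi> (x, y))
          (at x within {t. (t, y) \<in> D}) \<and>
        ((\<lambda>w. S (x, w)) has_real_derivative partial3 L x y (\<Phi> (x, y)))
          (at y within {w. (x, w) \<in> D}))"

lemma rl_derivative_works:
  assumes "rl_derivative_exists a b \<alpha> y" and "x \<in> {a..b}"
  shows "(rl_integral a (1 - \<alpha>) y has_real_derivative rl_derivative a b \<alpha> y x)
           (at x within {a..b})"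
  using assms
  by (simp add: rl_derivative_exists_def rl_derivative_def
      has_real_derivative_iff_has_vector_derivative vector_derivative_works)

text \<open>
  The integrand here is the linearisation of \<open>L(x, u, \<cdot>)\<close> at the slope \<open>\<Phi>(x, u)\<close> of the field,
  evaluated at the slope of \<open>u\<close>; its integral is Hilbert's invariant integral.
\<close>

lemma hilbert_invariant_integral:
  assumes "a < b" and sub: "{a..b} \<times> UNIV \<subseteq> D"
    and S: "field_potential a b D L \<Phi> S"
    and y: "rl_derivative_exists a b \<alpha> y"
  defines "u \<equiv> rl_integral a (1 - \<alpha>) y" and "v \<equiv> rl_derivative a b \<alpha> y"
  shows "((\<lambda>x. L x (u x) (\<Phi> (x, u x)) +
            partial3 L x (u x) (\<Phi> (x, u x)) * (v x - \<Phi> (x, u x)))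
          has_integral S (b, u b) - S (a, u a)) {a..b}"
proof (rule fundamental_theorem_of_calculus)
  show "a \<le> b"
    using \<open>a < b\<close> by simp
next
  fix x assume x: "x \<in> {a..b}"
  let ?\<phi> = "\<Phi> (x, u x)"
  let ?q = "partial3 L x (u x) ?\<phi>"
  have "((\<lambda>t. S (t, u t)) has_real_derivative
          (L x (u x) ?\<phi> - ?q * ?\<phi>) + ?q * v x) (at x within {a..b})"
    by (rule chain_rule_graph_strip[OF \<open>a < b\<close> x sub])
       (use S x rl_derivative_works[OF y x] in
         \<open>auto simp: field_potential_def u_def v_def\<close>)
  then show "((\<lambda>t. S (t, u t)) has_vector_derivative
      L x (u x) ?\<phi> + ?q * (v x - ?\<phi>)) (at x within {a..b})"
    by (simp add: has_real_derivative_iff_has_vector_derivative algebra_simps)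
qed

lemma frac_functional_has_integral:
  assumes "admissible L a b \<alpha> y"
  shows "(lagrangian_along L a b \<alpha> y has_integral frac_functional L a b \<alpha> y) {a..b}"
proof -
  have "set_integrable lebesgue {a..b} (lagrangian_along L a b \<alpha> y)"
    using assms by (simp add: admissible_def)
  from set_lebesgue_integral_eq_integral[OF this] show ?thesis
    by (simp add: frac_functional_def has_integral_iff)
qed

lemma increment_le_frac_functional:
  assumes "a < b" and "{a..b} \<times> UNIV \<subseteq> D"
    and convex: "convex_in_third L ({a..b} \<times> UNIV \<times> UNIV)"
    and "field_potential a b D L \<Phi> S" and y: "admissible L a b \<alpha> y"
  defines "u \<equiv> rl_integral a (1 - \<alpha>) y"
  shows "S (b, u b) - S (a, u a) \<le> frac_functional L a b \<alpha> y"
proof -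
  have "rl_derivative_exists a b \<alpha> y"
    using y by (simp add: admissible_def)
  note hilbert = hilbert_invariant_integral[OF assms(1,2,4) this]
  have tangent: "L x w s + partial3 L x w s * (r - s) \<le> L x w r" if "x \<in> {a..b}" for x w r s
  proof -
    have "L x w (s + (r - s)) - L x w s \<ge> partial3 L x w s * (r - s)"
      using convex that unfolding convex_in_third_def by blast
    then show ?thesis
      by simp
  qed
  show ?thesis
    unfolding u_def
    by (rule has_integral_le[OF hilbert frac_functional_has_integral[OF y]])
       (simp add: lagrangian_along_def tangent)
qed

lemma increment_eq_frac_functional:
  assumes "a < b" and "{a..b} \<times> UNIV \<subseteq> D"
    and "field_potential a b D L \<Phi> S" and y: "admissible L a b \<alpha> y"
    and field: "\<forall>x\<in>{a..b}. rl_derivative a b \<alpha> y x = \<Phi> (x, rl_integral a (1 - \<alpha>) y x)"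
  defines "u \<equiv> rl_integral a (1 - \<alpha>) y"
  shows "S (b, u b) - S (a, u a) = frac_functional L a b \<alpha> y"
proof -
  have "rl_derivative_exists a b \<alpha> y"
    using y by (simp add: admissible_def)
  note hilbert = hilbert_invariant_integral[OF assms(1-3) this]
  have "(lagrangian_along L a b \<alpha> y has_integral S (b, u b) - S (a, u a)) {a..b}"
    unfolding u_def
    by (rule has_integral_eq[OF _ hilbert]) (simp add: lagrangian_along_def field)
  then show ?thesis
    using frac_functional_has_integral[OF y] by (rule has_integral_unique)
qed

theorem theorem6p4:
  fixes a b \<alpha> :: real
    and L :: "real \<Rightarrow> real \<Rightarrow> real \<Rightarrow> real"
    and D :: "(real \<times> real) set"
    and \<Phi> :: "real \<times> real \<Rightarrow> real"
    and y0 :: "real \<Rightarrow> real"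
  assumes "a < b"
    and "0 < \<alpha>" and "\<alpha> < 1"
    and "convex_in_third L ({a..b} \<times> UNIV \<times> UNIV)"
    and "{a..b} \<times> UNIV \<subseteq> D"
    and "exact_field_covering a b D L \<Phi>"
    and "admissible L a b \<alpha> y0"
    and "\<forall>x\<in>{a..b}. rl_derivative a b \<alpha> y0 x = \<Phi> (x, rl_integral a (1 - \<alpha>) y0 x)"
  shows "\<forall>y. admissible L a b \<alpha> y \<and>
           rl_integral a (1 - \<alpha>) y a = rl_integral a (1 - \<alpha>) y0 a \<and>
           rl_integral a (1 - \<alpha>) y b = rl_integral a (1 - \<alpha>) y0 b \<longrightarrow>
           frac_functional L a b \<alpha> y0 \<le> frac_functional L a b \<alpha> y"
proof (intro allI impI, elim conjE)
  fix y
  assume y: "admissible L a b \<alpha> y"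
    and boundary: "rl_integral a (1 - \<alpha>) y a = rl_integral a (1 - \<alpha>) y0 a"
      "rl_integral a (1 - \<alpha>) y b = rl_integral a (1 - \<alpha>) y0 b"
  obtain S where S: "field_potential a b D L \<Phi> S"
    using assms(6) unfolding exact_field_covering_def field_potential_def by blast
  show "frac_functional L a b \<alpha> y0 \<le> frac_functional L a b \<alpha> y"
    using increment_eq_frac_functional[OF assms(1,5) S assms(7,8)]
      increment_le_frac_functional[OF assms(1,5,4) S y] boundary
    by simp
qed

end
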